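(* Let $ABCDEF$ be a convex hexagon in the Euclidean plane satisfying $\overline{AB} \parallel \overline{DE}$, $\overline{BC} \parallel \overline{EF}$, $\overline{CD} \parallel \overline{FA}$, and $$AB \cdot DE = BC \cdot EF = CD \cdot FA.$$ Let $X$, $Y$, and $Z$ be the midpoints of $\overline{AD}$, $\overline{BE}$, and $\overline{CF}$, respectively, and assume that the triangle $XYZ$ is nondegenerate. Then the circumcenter of $\triangle ACE$, the circumcenter of $\triangle BDF$, and the orthocenter of $\triangle XYZ$ are collinear.
   Context: Here $PQ$ denotes the length of the segment $\overline{PQ}$. *)

theory Defs
  imports "HOL-Analysis.Analysis"
begin

text \<open>
  The vertices are proper corners of the hexagon (no interior angle is straight), and their
  order matters: consecutive vertices are joined by edges of the convex hull, so
  the closed polygonal path is the boundary of the hull, without self-intersections.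
\<close>

definition convex_hexagon ::
  "real^2 \<Rightarrow> real^2 \<Rightarrow> real^2 \<Rightarrow> real^2 \<Rightarrow> real^2 \<Rightarrow> real^2 \<Rightarrow> bool" where
  "convex_hexagon A B C D E F \<longleftrightarrow>
     (let H = convex hull {A, B, C, D, E, F} in
       distinct [A, B, C, D, E, F] \<and>
       {P. P extreme_point_of H} = {A, B, C, D, E, F} \<and>
       closed_segment A B edge_of H \<and>
       closed_segment B C edge_of H \<and>
       closed_segment C D edge_of H \<and>
       closed_segment D E edge_of H \<and>
       closed_segment E F edge_of H \<and>
       closed_segment F A edge_of H)"

definition parallel_segments :: "real^2 \<Rightarrow> real^2 \<Rightarrow> real^2 \<Rightarrow> real^2 \<Rightarrow> bool" where
  "parallel_segments P Q R S \<longleftrightarrow>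
     P \<noteq> Q \<and> R \<noteq> S \<and> (\<exists>k::real. S - R = k *\<^sub>R (Q - P))"

text \<open>
  Both triangle centers are uniquely determined for non-collinear vertices; for collinear ones
  the values are not meaningful.
\<close>

definition circumcenter :: "real^2 \<Rightarrow> real^2 \<Rightarrow> real^2 \<Rightarrow> real^2" where
  "circumcenter P Q R = (THE U. dist U P = dist U Q \<and> dist U Q = dist U R)"

definition orthocenter :: "real^2 \<Rightarrow> real^2 \<Rightarrow> real^2 \<Rightarrow> real^2" where
  "orthocenter P Q R =
     (THE H. (H - P) \<bullet> (Q - R) = 0 \<and> (H - Q) \<bullet> (R - P) = 0 \<and> (H - R) \<bullet> (P - Q) = 0)"

end

theory Submission
  imports Defs
begin

text \<open>
  Complete the parallelograms \<open>ABCE'\<close>, \<open>CDEA'\<close>, \<open>EFAC'\<close>. Opposite sides of the hexagon are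
  antiparallel, so \<open>A\<close>, \<open>C\<close>, \<open>E\<close> lie on the side lines of the triangle \<open>A'C'E'\<close>, and the equal
  products say that they have equal power with respect to its circumcircle. Hence \<open>ACE\<close> and
  \<open>A'C'E'\<close> have the same circumcenter. The same holds for \<open>BDF\<close> and \<open>B'D'F'\<close>. The triangles
  \<open>A'C'E'\<close> and \<open>B'D'F'\<close> are homothetic to \<open>XYZ\<close> with ratio \<open>-2\<close>, and adding the equations of
  their perpendicular bisectors shows that the orthocenter of \<open>XYZ\<close> is the midpoint of the two
  circumcenters.
\<close>

section \<open>Planar cross product and 2x2 linear systems\<close>

definition cross2 :: "real^2 \<Rightarrow> real^2 \<Rightarrow> real" where
  "cross2 u v = u$1 * v$2 - u$2 * v$1"

lemma inner_real2: "(u::real^2) \<bullet> v = u$1 * v$1 + u$2 * v$2"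
  by (simp add: inner_vec_def sum_2)

lemma cross2_cyclic: "cross2 (B - A) (C - A) = cross2 (C - B) (A - B)"
  by (simp add: cross2_def algebra_simps)

lemma collinear_if_cross2_zero:
  assumes "cross2 (Q - P) (R - P) = 0"
  shows "collinear {P, Q, R}"
proof (cases "Q = P")
  case True
  then show ?thesis by simp
next
  case False
  define u where "u = Q - P"
  define v where "v = R - P"
  have u: "u \<bullet> u \<noteq> 0"
    using False by (simp add: u_def)
  have c: "u$1 * v$2 = u$2 * v$1"
    using assms by (simp add: cross2_def u_def v_def)
  \<comment> \<open>When the cross product vanishes, \<open>v\<close> equals its orthogonal
    projection onto \<open>u\<close>; this is that identity cleared of denominators.\<close>
  have "(u \<bullet> u) *\<^sub>R v = (u \<bullet> v) *\<^sub>R u"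
    unfolding vec_eq_iff forall_2 inner_real2 vector_scaleR_component real_scaleR_def
    using c by algebra
  then have "v = ((u \<bullet> v) / (u \<bullet> u)) *\<^sub>R u"
    using u by (metis divide_inverse_commute scaleR_scaleR scaleR_one left_inverse)
  then have R: "R = P + ((u \<bullet> v) / (u \<bullet> u)) *\<^sub>R u"
    by (simp add: v_def algebra_simps)
  have "P = P + 0 *\<^sub>R u" "Q = P + 1 *\<^sub>R u"
    by (simp_all add: u_def)
  with R show ?thesis
    unfolding collinear_alt by blast
qed

text \<open>Cramer's rule. Both triangle centers are solutions of such a system, so this is what
  makes their definite descriptions meaningful.\<close>

lemma ex1_inner_eq:
  assumes "cross2 u v \<noteq> 0"
  shows "\<exists>!w. w \<bullet> u = a \<and> w \<bullet> v = b"
proof (rule ex1I)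
  define d where "d = cross2 u v"
  have d: "d \<noteq> 0" using assms by (simp add: d_def)
  define w :: "real^2" where
    "w = vector [(a * v$2 - b * u$2) / d, (b * u$1 - a * v$1) / d]"
  have "d * (w \<bullet> u) = d * a" "d * (w \<bullet> v) = d * b"
    using d unfolding inner_real2 w_def vector_2
    by (simp_all add: field_simps) (simp_all add: d_def cross2_def algebra_simps)
  then show "w \<bullet> u = a \<and> w \<bullet> v = b"
    using d by simp
  fix x
  assume x: "x \<bullet> u = a \<and> x \<bullet> v = b"
  then have "d * x$1 = a * v$2 - b * u$2" "d * x$2 = b * u$1 - a * v$1"
    unfolding d_def cross2_def inner_real2 by (auto simp: algebra_simps)
  then show "x = w"
    using d by (simp add: vec_eq_iff forall_2 w_def field_simps)
qed

section \<open>Circumcenters and orthocenters\<close>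

text \<open>Expanding the squared distances cancels \<open>U \<bullet> U\<close>, so a perpendicular
  bisector becomes one linear equation in \<open>U\<close>.\<close>

lemma dist_eq_iff_inner:
  fixes U P Q :: "'a::real_inner"
  shows "dist U P = dist U Q \<longleftrightarrow> U \<bullet> (Q - P) = (Q \<bullet> Q - P \<bullet> P) / 2"
proof -
  have "dist U P = dist U Q \<longleftrightarrow> (U - P) \<bullet> (U - P) = (U - Q) \<bullet> (U - Q)"
    by (simp add: dist_norm norm_eq)
  also have "\<dots> \<longleftrightarrow> U \<bullet> (Q - P) = (Q \<bullet> Q - P \<bullet> P) / 2"
    by (auto simp: inner_simps inner_commute field_simps)
  finally show ?thesis .
qed

lemma ex1_circumcenter:
  assumes "\<not> collinear {P, Q, R :: real^2}"
  shows "\<exists>!U. dist U P = dist U Q \<and> dist U Q = dist U R"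
proof -
  have "cross2 (Q - P) (R - P) \<noteq> 0"
    using assms collinear_if_cross2_zero by blast
  then have "cross2 (Q - P) (R - Q) \<noteq> 0"
    by (simp add: cross2_def algebra_simps)
  then show ?thesis
    unfolding dist_eq_iff_inner by (rule ex1_inner_eq)
qed

lemma dist_circumcenter:
  assumes "\<not> collinear {P, Q, R}"
  shows "dist (circumcenter P Q R) P = dist (circumcenter P Q R) Q"
    and "dist (circumcenter P Q R) Q = dist (circumcenter P Q R) R"
  using theI'[OF ex1_circumcenter[OF assms]] unfolding circumcenter_def by blast+

lemma circumcenter_eqI:
  assumes "\<not> collinear {P, Q, R}" "dist U P = dist U Q" "dist U Q = dist U R"
  shows "circumcenter P Q R = U"
  unfolding circumcenter_def
  using the1_equality[OF ex1_circumcenter[OF assms(1)]] assms(2,3) by blast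

text \<open>Two sides of a nondegenerate triangle are linearly independent, so the altitudes through
  \<open>Q\<close> and \<open>R\<close> already meet in a single point.\<close>

lemma orthocenter_eqI:
  assumes "\<not> collinear {P, Q, R}"
    and "(H - P) \<bullet> (Q - R) = 0" "(H - Q) \<bullet> (R - P) = 0" "(H - R) \<bullet> (P - Q) = 0"
  shows "orthocenter P Q R = H"
  unfolding orthocenter_def
proof (rule the_equality)
  fix K
  assume K: "(K - P) \<bullet> (Q - R) = 0 \<and> (K - Q) \<bullet> (R - P) = 0 \<and> (K - R) \<bullet> (P - Q) = 0"
  have "cross2 (Q - P) (R - P) \<noteq> 0"
    using assms(1) collinear_if_cross2_zero by blast
  then have "cross2 (R - P) (P - Q) \<noteq> 0"
    by (simp add: cross2_def algebra_simps)
  from ex1_inner_eq[OF this, of "Q \<bullet> (R - P)" "R \<bullet> (P - Q)"] show "K = H"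
    using assms(3,4) K by (auto simp: inner_diff_left)
qed (use assms in blast)

section \<open>Extreme points and orientation in a convex hexagon\<close>

text \<open>Of three distinct collinear points one lies strictly between the other two, which an
  extreme point cannot do.\<close>

lemma not_collinear_extreme_points:
  fixes P Q R :: "'a::euclidean_space"
  assumes "P extreme_point_of H" "Q extreme_point_of H" "R extreme_point_of H"
    and "distinct [P, Q, R]"
  shows "\<not> collinear {P, Q, R}"
proof
  assume "collinear {P, Q, R}"
  then have "P \<in> open_segment Q R \<or> Q \<in> open_segment R P \<or> R \<in> open_segment P Q"
    using assms(4)
    by (auto simp: collinear_between_cases between_mem_segment open_segment_def closed_segment_commute)
  then show False
    using assms(1-3) unfolding extreme_point_of_def by blast
qed

text \<open>If \<open>R\<close> and \<open>S\<close> were on opposite sides of the line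
  \<open>PQ\<close>, the segment \<open>RS\<close> would cross it at some \<open>W\<close>. A
  crossing on the edge puts \<open>R\<close> into the face \<open>PQ\<close>, against extremality; a
  crossing outside it puts \<open>P\<close> or \<open>Q\<close> strictly inside a segment of
  \<open>H\<close>.\<close>

lemma cross2_edge_same_sign:
  assumes edge: "closed_segment P Q edge_of H" and "convex H"
    and ext: "P extreme_point_of H" "Q extreme_point_of H" "R extreme_point_of H" "S extreme_point_of H"
    and dist: "distinct [P, Q, R]" "distinct [P, Q, S]"
  shows "cross2 (Q - P) (R - P) * cross2 (Q - P) (S - P) > 0"
proof (rule ccontr)
  define r where "r = cross2 (Q - P) (R - P)"
  define s where "s = cross2 (Q - P) (S - P)"
  have "r \<noteq> 0"
    using not_collinear_extreme_points[OF ext(1-3) dist(1)] collinear_if_cross2_zero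
    unfolding r_def by blast
  moreover have "s \<noteq> 0"
    using not_collinear_extreme_points[OF ext(1,2,4) dist(2)] collinear_if_cross2_zero
    unfolding s_def by blast
  moreover assume "\<not> cross2 (Q - P) (R - P) * cross2 (Q - P) (S - P) > 0"
  ultimately have rs: "r < 0 \<and> s > 0 \<or> r > 0 \<and> s < 0"
    unfolding r_def[symmetric] s_def[symmetric]
    by (meson linorder_neqE_linordered_idom mult_neg_neg mult_pos_pos)
  \<comment> \<open>The weight at which the signed distance to the line \<open>PQ\<close>, affine
    along the segment \<open>RS\<close>, changes sign.\<close>
  define t where "t = r / (r - s)"
  have t: "0 < t" "t < 1" "(1 - t) * r + t * s = 0"
    using rs by (auto simp: t_def field_simps)
  define W where "W = (1 - t) *\<^sub>R R + t *\<^sub>R S"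
  have "R \<noteq> S"
    using rs unfolding r_def s_def by auto
  then have WRS: "W \<in> open_segment R S"
    using t unfolding in_segment W_def by blast
  have in_H: "P \<in> H" "Q \<in> H" "R \<in> H" "S \<in> H"
    using ext by (auto simp: extreme_point_of_def)
  then have "W \<in> H"
    using WRS \<open>convex H\<close> by (meson convex_contains_open_segment subsetD)
  have "cross2 (Q - P) (W - P) = (1 - t) * r + t * s"
    unfolding W_def r_def s_def cross2_def by (simp add: algebra_simps)
  then have "collinear {P, Q, W}"
    using t(3) by (intro collinear_if_cross2_zero) simp
  then consider "W \<in> closed_segment P Q" | "W \<notin> closed_segment P Q" "P \<in> closed_segment Q W"
    | "W \<notin> closed_segment P Q" "Q \<in> closed_segment W P"
    by (auto simp: collinear_between_cases between_mem_segment)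
  then show False
  proof cases
    case 1
    have "closed_segment P Q face_of H"
      using edge by (simp add: edge_of_def)
    then have "R \<in> closed_segment P Q"
      using WRS 1 in_H unfolding face_of_def by blast
    then have "R \<in> open_segment P Q"
      using dist by (auto simp: open_segment_def)
    then show False
      using ext(3) in_H unfolding extreme_point_of_def by blast
  next
    case 2
    then have "P \<in> open_segment Q W"
      using dist by (auto simp: open_segment_def)
    then show False
      using ext(1) in_H \<open>W \<in> H\<close> unfolding extreme_point_of_def by blast
  next
    case 3
    then have "Q \<in> open_segment W P"
      using dist by (auto simp: open_segment_def)
    then show False
      using ext(2) in_H \<open>W \<in> H\<close> unfolding extreme_point_of_def by blast
  qed
qed

lemma convex_hexagon_rotate:
  "convex_hexagon A B C D E F \<Longrightarrow> convex_hexagon B C D E F A"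
proof -
  have "{B, C, D, E, F, A} = {A, B, C, D, E, F}"
    by blast
  then show "convex_hexagon A B C D E F \<Longrightarrow> convex_hexagon B C D E F A"
    unfolding convex_hexagon_def Let_def by auto
qed

lemma convex_hexagon_extreme_points:
  assumes "convex_hexagon A B C D E F" "P \<in> {A, B, C, D, E, F}"
  shows "P extreme_point_of convex hull {A, B, C, D, E, F}"
  using assms unfolding convex_hexagon_def Let_def by blast

lemma convex_hexagon_edge_same_sign:
  assumes "convex_hexagon A B C D E F" "P \<in> {C, D, E, F}" "Q \<in> {C, D, E, F}"
  shows "cross2 (B - A) (P - A) * cross2 (B - A) (Q - A) > 0"
proof (rule cross2_edge_same_sign)
  show "closed_segment A B edge_of convex hull {A, B, C, D, E, F}"
    using assms(1) by (simp add: convex_hexagon_def Let_def)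
  show "distinct [A, B, P]" "distinct [A, B, Q]"
    using assms by (auto simp: convex_hexagon_def Let_def)
qed (use assms in \<open>auto intro!: convex_hexagon_extreme_points\<close>)

text \<open>Both signs agree with the orientation of the triangle \<open>ABC\<close>, which has
  \<open>AB\<close> and \<open>BC\<close> as sides. Hence the hexagon turns the same way at each
  edge.\<close>

lemma convex_hexagon_consecutive_edges:
  assumes "convex_hexagon A B C D E F"
  shows "cross2 (B - A) (D - A) > 0 \<longleftrightarrow> cross2 (C - B) (E - B) > 0"
proof -
  have "cross2 (B - A) (D - A) > 0 \<longleftrightarrow> cross2 (B - A) (C - A) > 0"
    using convex_hexagon_edge_same_sign[OF assms, of D C]
    by (auto simp: zero_less_mult_iff)
  also have "\<dots> \<longleftrightarrow> cross2 (C - B) (E - B) > 0"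
    using convex_hexagon_edge_same_sign[OF convex_hexagon_rotate[OF assms], of E A]
    unfolding cross2_cyclic[of B A] by (auto simp: zero_less_mult_iff)
  finally show ?thesis .
qed

lemma convex_hexagon_antiparallel:
  assumes hex: "convex_hexagon A B C D E F" and par: "parallel_segments A B D E"
  shows "\<exists>k>0. E - D = - k *\<^sub>R (B - A)"
proof -
  obtain k where k: "E - D = k *\<^sub>R (B - A)"
    using par unfolding parallel_segments_def by blast
  note hex' = convex_hexagon_rotate[OF hex]
  note hex'' = convex_hexagon_rotate[OF hex']
  \<comment> \<open>Three steps around the hexagon carry the edge \<open>AB\<close> to the opposite
    edge \<open>DE\<close>.\<close>
  have "cross2 (B - A) (D - A) > 0 \<longleftrightarrow> cross2 (E - D) (A - D) > 0"
    using convex_hexagon_consecutive_edges[OF hex] convex_hexagon_consecutive_edges[OF hex']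
      convex_hexagon_consecutive_edges[OF hex''] by simp
  moreover have "cross2 (B - A) (D - A) \<noteq> 0"
    using convex_hexagon_edge_same_sign[OF hex, of D D] by auto
  moreover have "cross2 (E - D) (A - D) \<noteq> 0"
    using convex_hexagon_edge_same_sign[OF convex_hexagon_rotate[OF hex''], of A A] by auto
  ultimately have "cross2 (B - A) (D - A) * cross2 (E - D) (A - D) > 0"
    by (auto simp: zero_less_mult_iff linorder_neq_iff)
  also have "cross2 (E - D) (A - D) = - k * cross2 (B - A) (D - A)"
    unfolding k by (simp add: cross2_def algebra_simps)
  finally have "- k > 0"
    by (auto simp: zero_less_mult_iff mult_less_0_iff)
  then show ?thesis
    using k by (intro exI[of _ "- k"]) simp
qed

section \<open>Power of a point and the common circumcenter\<close>

text \<open>A circle about \<open>U\<close> passes through \<open>P - u\<close> and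
  \<open>P + v\<close>. As \<open>v\<close> is a negative multiple of \<open>u\<close>, both points
  lie on the same side of \<open>P\<close>, so the power of \<open>P\<close> is positive and equals
  the product of the two lengths.\<close>

lemma power_of_point_on_chord:
  fixes P U u v :: "'a::real_inner"
  assumes "k > 0" "v = - k *\<^sub>R u" "P + v \<noteq> P - u" "dist U (P + v) = dist U (P - u)"
  shows "(dist U P)\<^sup>2 = (dist U (P - u))\<^sup>2 + norm u * norm v"
proof -
  define w where "w = P - U"
  have "k \<noteq> 1"
    using assms(2,3) by auto
  have "(w + v) \<bullet> (w + v) = (w - u) \<bullet> (w - u)"
    using assms(4) unfolding w_def dist_norm norm_eq
    by (simp add: algebra_simps inner_simps inner_commute)
  \<comment> \<open>The equidistance condition factors; \<open>1 - k\<close> vanishes only when the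
    two points coincide, which is excluded.\<close>
  then have "(1 - k) * (2 * (w \<bullet> u) - (1 + k) * (u \<bullet> u)) = 0"
    unfolding assms(2) by (simp add: inner_simps inner_commute algebra_simps)
  then have wu: "2 * (w \<bullet> u) = (1 + k) * (u \<bullet> u)"
    using \<open>k \<noteq> 1\<close> by simp
  have "(dist U (P - u))\<^sup>2 = (w - u) \<bullet> (w - u)"
    unfolding w_def dist_norm power2_norm_eq_inner
    by (simp add: algebra_simps inner_simps inner_commute)
  also have "\<dots> = w \<bullet> w - k * (u \<bullet> u)"
    using wu by (simp add: inner_simps inner_commute algebra_simps)
  also have "w \<bullet> w = (dist U P)\<^sup>2"
    unfolding w_def by (simp add: dist_commute dist_norm power2_norm_eq_inner[symmetric] norm_minus_commute)
  also have "k * (u \<bullet> u) = norm u * norm v"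
    using assms(1) by (simp add: assms(2) dot_square_norm power2_eq_square)
  finally show ?thesis by simp
qed

lemma circumcenter_alternate_vertices:
  assumes hex: "convex_hexagon A B C D E F"
    and par: "parallel_segments A B D E" "parallel_segments B C E F" "parallel_segments C D F A"
    and prod: "dist A B * dist D E = dist B C * dist E F" "dist B C * dist E F = dist C D * dist F A"
    and nc: "\<not> collinear {C + E - D, E + A - F, A + C - B}"
  shows "circumcenter A C E = circumcenter (C + E - D) (E + A - F) (A + C - B)"
proof -
  define U where "U = circumcenter (C + E - D) (E + A - F) (A + C - B)"
  note hex' = convex_hexagon_rotate[OF hex]
  note hex'' = convex_hexagon_rotate[OF hex']
  obtain k where k: "k > 0" "E - D = - k *\<^sub>R (B - A)"
    using convex_hexagon_antiparallel[OF hex par(1)] by blast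
  obtain l where l: "l > 0" "F - E = - l *\<^sub>R (C - B)"
    using convex_hexagon_antiparallel[OF hex' par(2)] by blast
  obtain m where m: "m > 0" "A - F = - m *\<^sub>R (D - C)"
    using convex_hexagon_antiparallel[OF hex'' par(3)] by blast
  have ne: "C + E - D \<noteq> E + A - F" "E + A - F \<noteq> A + C - B" "C + E - D \<noteq> A + C - B"
    using nc by (metis collinear_2 insert_absorb2 insert_commute)+
  note eq = dist_circumcenter[OF nc, folded U_def]
  have subtractions: "C - (B - A) = A + C - B" "A - (B - C) = A + C - B" "E - (D - C) = C + E - D"
    by simp_all
  \<comment> \<open>The line through \<open>C\<close> parallel to \<open>AB\<close> and
    \<open>DE\<close> contains the triangle vertices \<open>A + C - B\<close> and
    \<open>C + E - D\<close>.\<close>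
  have "(dist U C)\<^sup>2 = (dist U (C - (B - A)))\<^sup>2 + norm (B - A) * norm (E - D)"
    by (rule power_of_point_on_chord[OF k]) (use ne eq in \<open>simp_all add: algebra_simps\<close>)
  then have C: "(dist U C)\<^sup>2 = (dist U (A + C - B))\<^sup>2 + dist A B * dist D E"
    by (simp only: subtractions dist_norm norm_minus_commute[of A B] norm_minus_commute[of D E])
  \<comment> \<open>At \<open>A\<close> both displacements are taken reversed, so that subtracting
    \<open>B - C\<close> and adding \<open>E - F\<close> lead to the vertices
    \<open>A + C - B\<close> and \<open>E + A - F\<close>.\<close>
  have "E - F = - l *\<^sub>R (B - C)"
    using l(2) by (metis minus_diff_eq scaleR_minus_right)
  have "(dist U A)\<^sup>2 = (dist U (A - (B - C)))\<^sup>2 + norm (B - C) * norm (E - F)"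
    by (rule power_of_point_on_chord[OF l(1) \<open>E - F = _\<close>]) (use ne eq in \<open>simp_all add: algebra_simps\<close>)
  then have A: "(dist U A)\<^sup>2 = (dist U (A + C - B))\<^sup>2 + dist B C * dist E F"
    by (simp only: subtractions dist_norm)
  have "(dist U E)\<^sup>2 = (dist U (E - (D - C)))\<^sup>2 + norm (D - C) * norm (A - F)"
    by (rule power_of_point_on_chord[OF m]) (use ne eq in \<open>simp_all add: algebra_simps\<close>)
  then have E: "(dist U E)\<^sup>2 = (dist U (C + E - D))\<^sup>2 + dist C D * dist F A"
    by (simp only: subtractions dist_norm norm_minus_commute[of C D] norm_minus_commute[of F A])
  have AC: "dist U A = dist U C"
    by (rule power2_eq_imp_eq) (simp_all only: A C prod zero_le_dist)
  have CE: "dist U C = dist U E"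
    by (rule power2_eq_imp_eq) (simp_all only: E C prod eq zero_le_dist)
  have "\<not> collinear {A, C, E}"
    by (rule not_collinear_extreme_points[OF convex_hexagon_extreme_points[OF hex]
          convex_hexagon_extreme_points[OF hex] convex_hexagon_extreme_points[OF hex]])
      (use hex in \<open>simp_all add: convex_hexagon_def Let_def\<close>)
  then show ?thesis
    using AC CE unfolding U_def[symmetric] by (rule circumcenter_eqI)
qed

section \<open>Homothety with the midpoint triangle and its orthocenter\<close>

text \<open>Used in contrapositive form, it transfers the nondegeneracy of \<open>XYZ\<close> to the
  two larger triangles, whose circumcenters are then determined.\<close>

lemma collinear_homothetic:
  fixes P Q R :: "'a::real_vector"
  assumes "collinear {P, Q, R}" "Y - X = c *\<^sub>R (Q - P)" "Z - X = c *\<^sub>R (R - P)"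
  shows "collinear {X, Y, Z}"
proof -
  obtain u where u: "\<forall>x\<in>{P, Q, R}. \<forall>y\<in>{P, Q, R}. \<exists>t. x - y = t *\<^sub>R u"
    using assms(1) unfolding collinear_def by blast
  then obtain q r where qr: "Q - P = q *\<^sub>R u" "R - P = r *\<^sub>R u"
    by blast
  have Y: "Y = X + (c * q) *\<^sub>R u" and Z: "Z = X + (c * r) *\<^sub>R u"
    using assms(2,3) qr by (simp_all add: algebra_simps)
  have "\<exists>t. x = X + t *\<^sub>R u" if "x \<in> {X, Y, Z}" for x
    using that Y Z by (auto intro: exI[of _ 0])
  then show ?thesis
    unfolding collinear_alt by blast
qed

text \<open>The bisectors of \<open>PQ\<close> and \<open>RS\<close> are both orthogonal to
  \<open>w\<close>. Averaging their equations puts \<open>midpoint U V\<close> on the parallel line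
  through the average of the two segment midpoints, which is \<open>Z\<close>.\<close>

lemma midpoint_orthogonal_bisectors:
  fixes U V :: "'a::real_inner"
  assumes "dist U P = dist U Q" "dist V R = dist V S"
    and "Q - P = 2 *\<^sub>R w" "S - R = 2 *\<^sub>R w" "P + Q + R + S = 4 *\<^sub>R Z"
  shows "(midpoint U V - Z) \<bullet> w = 0"
proof -
  have bisector: "(T - midpoint M N) \<bullet> w = 0" if "dist T M = dist T N" "N - M = 2 *\<^sub>R w"
    for T M N :: 'a
  proof -
    have "(T - midpoint M N) \<bullet> (N - M) = T \<bullet> (N - M) - (N \<bullet> N - M \<bullet> M) / 2"
      by (simp add: midpoint_def inner_simps inner_commute field_simps)
    then have "(T - midpoint M N) \<bullet> (N - M) = 0"
      using that(1) unfolding dist_eq_iff_inner by linarith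
    then show ?thesis
      using that(2) by simp
  qed
  have "midpoint U V - Z = (1 / 2) *\<^sub>R ((U + V) - (1 / 2) *\<^sub>R (4 *\<^sub>R Z))"
    by (simp add: midpoint_def algebra_simps)
  also have "\<dots> = (1 / 2) *\<^sub>R ((U - midpoint P Q) + (V - midpoint R S))"
    unfolding assms(5)[symmetric] by (simp add: midpoint_def algebra_simps)
  finally show ?thesis
    using bisector[OF assms(1,3)] bisector[OF assms(2,4)]
    by (simp add: inner_add_left)
qed

lemma orthocenter_eq_midpoint_circumcenters:
  fixes A B C D E F X Y Z :: "real^2"
  assumes "convex_hexagon A B C D E F"
    and "parallel_segments A B D E"
    and "parallel_segments B C E F"
    and "parallel_segments C D F A"
    and "dist A B * dist D E = dist B C * dist E F"
    and "dist B C * dist E F = dist C D * dist F A"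
    and "X = midpoint A D"
    and "Y = midpoint B E"
    and "Z = midpoint C F"
    and "\<not> collinear {X, Y, Z}"
  shows "orthocenter X Y Z = midpoint (circumcenter A C E) (circumcenter B D F)"
proof -
  obtain k where k: "k > 0" "E - D = - k *\<^sub>R (B - A)"
    using convex_hexagon_antiparallel[OF assms(1,2)] by blast
  \<comment> \<open>The hexagon starting at \<open>B\<close> needs the pair \<open>AB\<close>,
    \<open>DE\<close> in the opposite order, so the scaling factor is inverted.\<close>
  have "B - A = (- 1 / k) *\<^sub>R (E - D)"
    unfolding k(2) using k(1) by simp
  then have sym: "parallel_segments D E A B"
    using assms(2) unfolding parallel_segments_def by blast
  have mid: "A + D = 2 *\<^sub>R X" "B + E = 2 *\<^sub>R Y" "C + F = 2 *\<^sub>R Z"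
    unfolding assms midpoint_def by simp_all
  \<comment> \<open>Eliminating \<open>D\<close>, \<open>E\<close> and \<open>F\<close> turns the
    homothety relations below into identities in \<open>A\<close>, \<open>B\<close>,
    \<open>C\<close>, \<open>X\<close>, \<open>Y\<close>, \<open>Z\<close>.\<close>
  then have D: "D = 2 *\<^sub>R X - A" and E: "E = 2 *\<^sub>R Y - B" and F: "F = 2 *\<^sub>R Z - C"
    by (simp_all add: algebra_simps)
  have nc1: "\<not> collinear {C + E - D, E + A - F, A + C - B}"
  proof
    assume "collinear {C + E - D, E + A - F, A + C - B}"
    then have "collinear {X, Z, Y}"
      by (rule collinear_homothetic[where c = "- 1 / 2"]) (simp_all add: D E F algebra_simps)
    then show False using assms(10) by (simp add: insert_commute)
  qed
  have nc2: "\<not> collinear {D + F - E, F + B - A, B + D - C}"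
  proof
    assume "collinear {D + F - E, F + B - A, B + D - C}"
    then have "collinear {Y, X, Z}"
      by (rule collinear_homothetic[where c = "- 1 / 2"]) (simp_all add: D E F algebra_simps)
    then show False using assms(10) by (simp add: insert_commute)
  qed
  define U where "U = circumcenter A C E"
  define V where "V = circumcenter B D F"
  have U: "U = circumcenter (C + E - D) (E + A - F) (A + C - B)"
    unfolding U_def by (rule circumcenter_alternate_vertices[OF assms(1-6) nc1])
  have V: "V = circumcenter (D + F - E) (F + B - A) (B + D - C)"
    unfolding V_def
  proof (rule circumcenter_alternate_vertices[OF convex_hexagon_rotate[OF assms(1)] assms(3,4) sym assms(6) _ nc2])
    show "dist C D * dist F A = dist D E * dist A B"
      using assms(5,6) by (simp only: mult.commute)
  qed
  note Ueq = dist_circumcenter[OF nc1, folded U]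
  note Veq = dist_circumcenter[OF nc2, folded V]
  show ?thesis
    unfolding U_def[symmetric] V_def[symmetric]
  proof (rule orthocenter_eqI[OF assms(10)])
    \<comment> \<open>The sides from \<open>A + C - B\<close> to \<open>E + A - F\<close> and from
      \<open>D + F - E\<close> to \<open>B + D - C\<close> are both twice \<open>Y - Z\<close>, and
      their four endpoints sum to four times \<open>X\<close>. The other two altitudes come from the
      other corresponding sides.\<close>
    show "(midpoint U V - X) \<bullet> (Y - Z) = 0"
      by (rule midpoint_orthogonal_bisectors[OF Ueq(2)[symmetric] trans[OF Veq]])
        (simp_all add: D E F algebra_simps flip: scaleR_add_left)
    show "(midpoint U V - Y) \<bullet> (Z - X) = 0"
      by (rule midpoint_orthogonal_bisectors[OF Ueq(1)[symmetric] Veq(2)[symmetric]])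
        (simp_all add: D E F algebra_simps flip: scaleR_add_left)
    show "(midpoint U V - Z) \<bullet> (X - Y) = 0"
      by (rule midpoint_orthogonal_bisectors[OF trans[OF Ueq] Veq(1)[symmetric]])
        (simp_all add: D E F algebra_simps flip: scaleR_add_left)
  qed
qed

theorem mainTheorem6:
  fixes A B C D E F X Y Z :: "real^2"
  assumes "convex_hexagon A B C D E F"
    and "parallel_segments A B D E"
    and "parallel_segments B C E F"
    and "parallel_segments C D F A"
    and "dist A B * dist D E = dist B C * dist E F"
    and "dist B C * dist E F = dist C D * dist F A"
    and "X = midpoint A D"
    and "Y = midpoint B E"
    and "Z = midpoint C F"
    and "\<not> collinear {X, Y, Z}"
  shows "collinear {circumcenter A C E, circumcenter B D F, orthocenter X Y Z}"
proof -
  \<comment> \<open>The reordering matches the form of \<open>collinear_midpoint\<close>, with the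
    midpoint listed between its endpoints.\<close>
  have "{P, Q, midpoint P Q} = {P, midpoint P Q, Q}" for P Q :: "real^2"
    by blast
  then show ?thesis
    by (simp only: orthocenter_eq_midpoint_circumcenters[OF assms] collinear_midpoint)
qed

end
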